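(* Let $\mathcal{K}=\langle\mathcal{T},\mathcal{D},\mathcal{A}\rangle$ be a defeasible DL-Lite$_{horn}^{\mathcal{H}}$ knowledge base whose pair $\langle\mathcal{T},\mathcal{D}\rangle$ has been processed, i.e. each defeasible inclusion $\{B_1,\ldots,B_n\}\mathrel{\sqsubset_\sim}A$ of rank $\infty$ has been eliminated from $\mathcal{D}$ and the corresponding inclusion $\{B_1,\ldots,B_n\}\sqsubseteq\bot$ has been added to $\mathcal{T}$. Then $\mathcal{K}$ is satisfiable (has a ranked model) if and only if $\langle\mathcal{T},\mathcal{A}\rangle$ is (classically) satisfiable.
   Context: **Syntax.** Fix finite sets of individuals ($a,b$), concept names ($A$) and role names ($P$). Roles: $R::=P\mid P^-$ (with $(P^-)^-=P$). Basic concepts: $B::=A\mid\exists R$. Concepts: $C::=B\mid\neg B$. A DL-Lite$_{horn}^{\mathcal{H}}$ TBox $\mathcal{T}$ is a finite set of concept inclusions $\{B_1,\ldots,B_n\}\sqsubseteq C$ ($n\ge1$) and role inclusions $R_1\sqsubseteq R_2$; whenever $R_1\sqsubseteq R_2\in\mathcal{T}$, also $\exists R_1\sqsubseteq\exists R_2$ and $\exists R_1^-\sqsubseteq\exists R_2^-$ are in $\mathcal{T}$. A DBox $\mathcal D$ is a finite set of defeasible inclusions (DIs) $\{B_1,\ldots,B_n\}\mathrel{\sqsubset_\sim}A$. An ABox $\mathcal A$ is a finite set of assertions $a{:}A$ and $(a,b){:}P$. $\{B_1,\ldots,B_n\}\sqsubseteq\bot$ stands for $\{B_1,\ldots,B_{n-1}\}\sqsubseteq\neg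 B_n$ (for $n=1$: $B_1\sqsubseteq\neg B_1$). **Semantics.** An interpretation has nonempty domain $\Delta^{\mathcal I}$, $A^{\mathcal I}\subseteq\Delta^{\mathcal I}$, $P^{\mathcal I}\subseteq\Delta^{\mathcal I}\times\Delta^{\mathcal I}$, $a^{\mathcal I}\in\Delta^{\mathcal I}$, with distinct individuals interpreted as distinct elements; $(P^-)^{\mathcal I}$ is the converse relation, $(\exists R)^{\mathcal I}=\{x\mid\exists y\,(x,y)\in R^{\mathcal I}\}$, $(\neg B)^{\mathcal I}=\Delta^{\mathcal I}\setminus B^{\mathcal I}$, $\{B_1,\ldots,B_n\}^{\mathcal I}=\bigcap_k B_k^{\mathcal I}$. A ranked interpretation $\mathcal{R}=\langle\Delta^{\mathcal R},\cdot^{\mathcal R},\prec^{\mathcal R}\rangle$ is an interpretation with a strict order such that there is $h_{\mathcal R}:\Delta^{\mathcal R}\to\mathbb N$ whose range is closed downwards and $x\prec^{\mathcal R}y$ iff $h_{\mathcal R}(x)<h_{\mathcal R}(y)$. It satisfies classical inclusions and assertions as usual, and satisfies $\{B_1,\ldots,B_n\}\mathrel{\sqsubset_\sim}A$ iff all $\prec^{\mathcal R}$-minimal elements of $\bigcap_kB_k^{\mathcal R}$ are in $A^{\mathcal R}$. It is a ranked model of a KB if it satisfies all its elements. **Rank.** A finite set of concepts is exceptional w.r.t. $\langle\mathcal T,\mathcal D\rangle$ if in every ranked model of $\langle\mathcal T,\mathcal D\rangle$ no element of height $0$ belongs to all of them. Put $\mathcal K^0=\langle\mathcal T,\mathcal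 D\rangle$; a DI has the rank of its left-hand side; $\mathcal D_i$ is the set of DIs of rank $i$; $\mathcal K^i=\langle\mathcal T,\mathcal D\setminus\bigcup_{j<i}\mathcal D_j\rangle$. The rank of a set of concepts is the least $i$ such that it is not exceptional w.r.t. $\mathcal K^i$, and $\infty$ if there is none. Being processed means that $\langle\mathcal T,\mathcal D\rangle$ is the result of the stated elimination, carried out until no DI of rank $\infty$ remains; thus every DI in $\mathcal D$ has finite rank. *)

theory Defs
  imports Main "HOL-Library.Extended_Nat"
begin

section \<open>Syntax\<close>

text \<open>Individuals, concept names and role names are the elements of the types
  \<open>'i\<close>, \<open>'c\<close>, \<open>'r\<close>.\<close>

datatype 'r role = Name 'r | Inverse 'r

fun inv_role :: "'r role \<Rightarrow> 'r role" where
  "inv_role (Name P) = Inverse P"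
| "inv_role (Inverse P) = Name P"

datatype ('c, 'r) basic = Atom 'c | Ex "'r role"

datatype ('c, 'r) concept = Pos "('c, 'r) basic" | Neg "('c, 'r) basic"

datatype ('c, 'r) tbox_axiom =
    ConceptIncl "('c, 'r) basic set" "('c, 'r) concept"
  | RoleIncl "'r role" "'r role"

datatype ('c, 'r) di = DI (lhs: "('c, 'r) basic set") (rhs: 'c)

datatype ('i, 'c, 'r) assertion =
    ConceptAssert 'i 'c
  | RoleAssert 'i 'i 'r

definition is_tbox :: "('c, 'r) tbox_axiom set \<Rightarrow> bool" where
  "is_tbox T \<longleftrightarrow> finite T
     \<and> (\<forall>Bs C. ConceptIncl Bs C \<in> T \<longrightarrow> finite Bs \<and> Bs \<noteq> {})
     \<and> (\<forall>R1 R2. RoleIncl R1 R2 \<in> T \<longrightarrow>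
          ConceptIncl {Ex R1} (Pos (Ex R2)) \<in> T
          \<and> ConceptIncl {Ex (inv_role R1)} (Pos (Ex (inv_role R2))) \<in> T)"

definition is_dbox :: "('c, 'r) di set \<Rightarrow> bool" where
  "is_dbox D \<longleftrightarrow> finite D \<and> (\<forall>d\<in>D. finite (lhs d) \<and> lhs d \<noteq> {})"

definition is_kb ::
  "('c, 'r) tbox_axiom set \<Rightarrow> ('c, 'r) di set \<Rightarrow> ('i, 'c, 'r) assertion set \<Rightarrow> bool" where
  "is_kb T D A \<longleftrightarrow> is_tbox T \<and> is_dbox D \<and> finite A"

text \<open>The inclusion \<open>{B\<^sub>1, \<dots>, B\<^sub>n} \<sqsubseteq> \<bottom>\<close> abbreviates \<open>{B\<^sub>1, \<dots>, B\<^sub>n\<^sub>-\<^sub>1} \<sqsubseteq> \<not> B\<^sub>n\<close>.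
  Since the left-hand side is a set, the choice of the last element is arbitrary;
  all admissible choices are collected.\<close>

definition bot_incls :: "('c, 'r) basic set \<Rightarrow> ('c, 'r) tbox_axiom set" where
  "bot_incls Bs = {ConceptIncl (if Bs = {B} then {B} else Bs - {B}) (Neg B) | B. B \<in> Bs}"


section \<open>Classical semantics\<close>

record ('d, 'i, 'c, 'r) interp =
  dom :: "'d set"
  conc :: "'c \<Rightarrow> 'd set"
  rol :: "'r \<Rightarrow> ('d \<times> 'd) set"
  ind :: "'i \<Rightarrow> 'd"

definition is_interp :: "('d, 'i, 'c, 'r, 'z) interp_scheme \<Rightarrow> bool" where
  "is_interp I \<longleftrightarrow> dom I \<noteq> {}
     \<and> (\<forall>A. conc I A \<subseteq> dom I)
     \<and> (\<forall>P. rol I P \<subseteq> dom I \<times> dom I)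
     \<and> (\<forall>a. ind I a \<in> dom I)
     \<and> inj (ind I)"

fun role_ext :: "('d, 'i, 'c, 'r, 'z) interp_scheme \<Rightarrow> 'r role \<Rightarrow> ('d \<times> 'd) set" where
  "role_ext I (Name P) = rol I P"
| "role_ext I (Inverse P) = (rol I P)\<inverse>"

fun basic_ext :: "('d, 'i, 'c, 'r, 'z) interp_scheme \<Rightarrow> ('c, 'r) basic \<Rightarrow> 'd set" where
  "basic_ext I (Atom A) = conc I A"
| "basic_ext I (Ex R) = {x. \<exists>y. (x, y) \<in> role_ext I R}"

fun concept_ext :: "('d, 'i, 'c, 'r, 'z) interp_scheme \<Rightarrow> ('c, 'r) concept \<Rightarrow> 'd set" where
  "concept_ext I (Pos B) = basic_ext I B"
| "concept_ext I (Neg B) = dom I - basic_ext I B"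

definition basics_ext :: "('d, 'i, 'c, 'r, 'z) interp_scheme \<Rightarrow> ('c, 'r) basic set \<Rightarrow> 'd set" where
  "basics_ext I Bs = (\<Inter>B\<in>Bs. basic_ext I B)"

fun sat_tbox_axiom :: "('d, 'i, 'c, 'r, 'z) interp_scheme \<Rightarrow> ('c, 'r) tbox_axiom \<Rightarrow> bool" where
  "sat_tbox_axiom I (ConceptIncl Bs C) \<longleftrightarrow> basics_ext I Bs \<subseteq> concept_ext I C"
| "sat_tbox_axiom I (RoleIncl R1 R2) \<longleftrightarrow> role_ext I R1 \<subseteq> role_ext I R2"

fun sat_assertion :: "('d, 'i, 'c, 'r, 'z) interp_scheme \<Rightarrow> ('i, 'c, 'r) assertion \<Rightarrow> bool" where
  "sat_assertion I (ConceptAssert a A) \<longleftrightarrow> ind I a \<in> conc I A"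
| "sat_assertion I (RoleAssert a b P) \<longleftrightarrow> (ind I a, ind I b) \<in> rol I P"

text \<open>Quantification over all interpretations is relative to a type \<open>'d\<close> of which the domains
  are nonempty subsets.\<close>

definition classically_satisfiable ::
  "'d itself \<Rightarrow> ('c, 'r) tbox_axiom set \<Rightarrow> ('i, 'c, 'r) assertion set \<Rightarrow> bool" where
  "classically_satisfiable _ T A \<longleftrightarrow>
     (\<exists>I :: ('d, 'i, 'c, 'r) interp. is_interp I
        \<and> (\<forall>ax\<in>T. sat_tbox_axiom I ax) \<and> (\<forall>as\<in>A. sat_assertion I as))"

lemma sat_bot_incl:
  assumes "is_interp I" "ax \<in> bot_incls Bs"
  shows "sat_tbox_axiom I ax \<longleftrightarrow> basics_ext I Bs = {}"
proof -
  have dom: "basic_ext I B \<subseteq> dom I" for B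
  proof (cases B)
    case (Ex R)
    then show ?thesis using assms(1) by (cases R) (auto simp: is_interp_def)
  qed (use assms(1) in \<open>auto simp: is_interp_def\<close>)
  obtain B where B: "B \<in> Bs"
    and ax: "ax = ConceptIncl (if Bs = {B} then {B} else Bs - {B}) (Neg B)"
    using assms(2) by (auto simp: bot_incls_def)
  show ?thesis
  proof (cases "Bs = {B}")
    case True
    then show ?thesis using ax dom[of B] by (auto simp: basics_ext_def)
  next
    case False
    then obtain B' where B': "B' \<in> Bs - {B}" using B by blast
    have "basics_ext I (Bs - {B}) \<subseteq> dom I"
      using B' dom[of B'] unfolding basics_ext_def by blast
    moreover have "basics_ext I Bs = basics_ext I (Bs - {B}) \<inter> basic_ext I B"
      using B unfolding basics_ext_def by blast
    ultimately show ?thesis using ax False by auto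
  qed
qed


section \<open>Ranked semantics\<close>

record ('d, 'i, 'c, 'r) ranked_interp = "('d, 'i, 'c, 'r) interp" +
  prec :: "('d \<times> 'd) set"

definition height_function :: "('d, 'i, 'c, 'r) ranked_interp \<Rightarrow> ('d \<Rightarrow> nat) \<Rightarrow> bool" where
  "height_function R h \<longleftrightarrow>
     (\<forall>n \<in> h ` dom R. \<forall>m \<le> n. m \<in> h ` dom R)
     \<and> (\<forall>x\<in>dom R. \<forall>y\<in>dom R. (x, y) \<in> prec R \<longleftrightarrow> h x < h y)"

definition is_ranked_interp :: "('d, 'i, 'c, 'r) ranked_interp \<Rightarrow> bool" where
  "is_ranked_interp R \<longleftrightarrow> is_interp R
     \<and> prec R \<subseteq> dom R \<times> dom R \<and> irrefl (prec R) \<and> trans (prec R)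
     \<and> (\<exists>h. height_function R h)"

definition height :: "('d, 'i, 'c, 'r) ranked_interp \<Rightarrow> 'd \<Rightarrow> nat" where
  "height R x = (THE n. \<exists>h. height_function R h \<and> h x = n)"

text \<open>The order determines the height function on the domain.\<close>

lemma height_eq:
  assumes "height_function R h" "x \<in> dom R"
  shows "height R x = h x"
proof -
  have *: "f x \<le> g x"
    if f: "height_function R f" and g: "height_function R g" and x: "x \<in> dom R" for f g x
    using x
  proof (induction "g x" arbitrary: x rule: less_induct)
    case less
    show ?case
    proof (rule ccontr)
      assume "\<not> f x \<le> g x"
      then have lt: "g x < f x" by simp
      then have "g x \<in> f ` dom R"
        using f less.prems less_imp_le[OF lt] unfolding height_function_def by blast
      then obtain y where y: "y \<in> dom R" "f y = g x" by auto
      then have "(y, x) \<in> prec R"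
        using f lt less.prems unfolding height_function_def by simp
      then have yx: "g y < g x" using g y(1) less.prems unfolding height_function_def by blast
      then have "f y \<le> g y" using less.hyps y(1) by blast
      then show False using yx y(2) by simp
    qed
  qed
  show ?thesis unfolding height_def
  proof (rule the_equality)
    show "\<exists>f. height_function R f \<and> f x = h x" using assms(1) by blast
  next
    fix n assume "\<exists>f. height_function R f \<and> f x = n"
    then obtain f where f: "height_function R f" and n: "f x = n" by blast
    show "n = h x"
      using *[OF f assms(1,2)] *[OF assms(1) f assms(2)] n by simp
  qed
qed

definition minimal_elems :: "('d, 'i, 'c, 'r) ranked_interp \<Rightarrow> 'd set \<Rightarrow> 'd set" where
  "minimal_elems R X = {x \<in> X. \<not> (\<exists>y\<in>X. (y, x) \<in> prec R)}"

definition sat_di :: "('d, 'i, 'c, 'r) ranked_interp \<Rightarrow> ('c, 'r) di \<Rightarrow> bool" where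
  "sat_di R d \<longleftrightarrow> minimal_elems R (basics_ext R (lhs d)) \<subseteq> conc R (rhs d)"

definition ranked_model ::
  "('d, 'i, 'c, 'r) ranked_interp \<Rightarrow> ('c, 'r) tbox_axiom set \<Rightarrow> ('c, 'r) di set \<Rightarrow>
     ('i, 'c, 'r) assertion set \<Rightarrow> bool" where
  "ranked_model R T D A \<longleftrightarrow> is_ranked_interp R
     \<and> (\<forall>ax\<in>T. sat_tbox_axiom R ax) \<and> (\<forall>d\<in>D. sat_di R d) \<and> (\<forall>as\<in>A. sat_assertion R as)"

definition satisfiable ::
  "'d itself \<Rightarrow> ('c, 'r) tbox_axiom set \<Rightarrow> ('c, 'r) di set \<Rightarrow>
     ('i, 'c, 'r) assertion set \<Rightarrow> bool" where
  "satisfiable _ T D A \<longleftrightarrow> (\<exists>R :: ('d, 'i, 'c, 'r) ranked_interp. ranked_model R T D A)"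


section \<open>Rank\<close>

text \<open>Neither the domain type nor the type of individuals occurs in a TBox or a DBox, so both
  are passed explicitly.\<close>

definition exceptional ::
  "'d itself \<Rightarrow> 'i itself \<Rightarrow> ('c, 'r) tbox_axiom set \<Rightarrow> ('c, 'r) di set \<Rightarrow>
     ('c, 'r) concept set \<Rightarrow> bool" where
  "exceptional _ _ T D Cs \<longleftrightarrow>
     (\<forall>R :: ('d, 'i, 'c, 'r) ranked_interp. ranked_model R T D {} \<longrightarrow>
        \<not> (\<exists>x\<in>dom R. height R x = 0 \<and> (\<forall>C\<in>Cs. x \<in> concept_ext R C)))"

text \<open>\<open>residual U V T D i\<close> is the DBox of \<open>\<K>\<^sup>i\<close>. A DI that is left in \<open>\<K>\<^sup>i\<close> has rank at least
  \<open>i\<close>, so the DIs of rank \<open>i\<close> are those left in \<open>\<K>\<^sup>i\<close> whose left-hand side is not exceptional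
  w.r.t. \<open>\<K>\<^sup>i\<close>. The description by removal of all DIs of rank below \<open>i\<close> is lemma
  \<open>residual_eq\<close>.\<close>

primrec residual ::
  "'d itself \<Rightarrow> 'i itself \<Rightarrow> ('c, 'r) tbox_axiom set \<Rightarrow> ('c, 'r) di set \<Rightarrow> nat \<Rightarrow>
     ('c, 'r) di set" where
  "residual U V T D 0 = D"
| "residual U V T D (Suc i) = residual U V T D i -
     {d \<in> residual U V T D i. \<not> exceptional U V T (residual U V T D i) (Pos ` lhs d)}"

definition rank ::
  "'d itself \<Rightarrow> 'i itself \<Rightarrow> ('c, 'r) tbox_axiom set \<Rightarrow> ('c, 'r) di set \<Rightarrow>
     ('c, 'r) concept set \<Rightarrow> enat" where
  "rank U V T D Cs =
     (if \<exists>i. \<not> exceptional U V T (residual U V T D i) Cs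
      then enat (LEAST i. \<not> exceptional U V T (residual U V T D i) Cs) else \<infinity>)"

definition di_rank ::
  "'d itself \<Rightarrow> 'i itself \<Rightarrow> ('c, 'r) tbox_axiom set \<Rightarrow> ('c, 'r) di set \<Rightarrow>
     ('c, 'r) di \<Rightarrow> enat" where
  "di_rank U V T D d = rank U V T D (Pos ` lhs d)"

lemma residual_eq:
  "residual U V T D i = D - (\<Union>j<i. {d \<in> D. di_rank U V T D d = enat j})"
proof -
  define e where "e j d = exceptional U V T (residual U V T D j) (Pos ` lhs d)" for j d
  have Suc_iff: "d \<in> residual U V T D (Suc i) \<longleftrightarrow> d \<in> residual U V T D i \<and> e i d" for i d
    unfolding e_def by auto
  have res: "d \<in> residual U V T D i \<longleftrightarrow> d \<in> D \<and> (\<forall>j<i. e j d)" for i d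
  proof (induction i)
    case (Suc i)
    show ?case unfolding Suc_iff Suc.IH All_less_Suc by blast
  qed simp
  have rank: "di_rank U V T D d =
      (if \<exists>j. \<not> e j d then enat (LEAST j. \<not> e j d) else \<infinity>)" for d
    unfolding di_rank_def rank_def e_def ..
  have "(\<forall>j<i. e j d) \<longleftrightarrow> \<not> (\<exists>j<i. di_rank U V T D d = enat j)" for d
  proof (cases "\<exists>j. \<not> e j d")
    case True
    then have "\<not> e (LEAST j. \<not> e j d) d" by (rule LeastI_ex)
    moreover have "(LEAST j. \<not> e j d) \<le> j" if "\<not> e j d" for j
      using that by (rule Least_le)
    ultimately have "(\<exists>j<i. \<not> e j d) \<longleftrightarrow> (LEAST j. \<not> e j d) < i"
      using le_less_trans by blast
    then show ?thesis using True by (simp add: rank) blast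
  next
    case False
    then show ?thesis by (simp add: rank)
  qed
  then show ?thesis by (simp add: set_eq_iff res) blast
qed


section \<open>Elimination of defeasible inclusions of infinite rank\<close>

inductive eliminate ::
  "'d itself \<Rightarrow> 'i itself \<Rightarrow> ('c, 'r) tbox_axiom set \<times> ('c, 'r) di set \<Rightarrow>
     ('c, 'r) tbox_axiom set \<times> ('c, 'r) di set \<Rightarrow> bool"
  for U V where
  "d \<in> D \<Longrightarrow> di_rank U V T D d = \<infinity> \<Longrightarrow> ax \<in> bot_incls (lhs d) \<Longrightarrow>
     eliminate U V (T, D) (insert ax T, D - {d})"

definition processed ::
  "'d itself \<Rightarrow> 'i itself \<Rightarrow> ('c, 'r) tbox_axiom set \<Rightarrow> ('c, 'r) di set \<Rightarrow> bool" where
  "processed U V T D \<longleftrightarrow>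
     (\<exists>T\<^sub>0 D\<^sub>0. is_tbox T\<^sub>0 \<and> is_dbox D\<^sub>0 \<and> (eliminate U V)\<^sup>*\<^sup>* (T\<^sub>0, D\<^sub>0) (T, D))
     \<and> (\<forall>d\<in>D. di_rank U V T D d \<noteq> \<infinity>)"

end

theory Submission imports Defs begin

text \<open>
  The direction from left to right only requires changing the domain type: filtration by the set
  of satisfied basic concepts, with named elements kept apart, turns any model into a finite one.

  Conversely, let \<open>d\<close> be a DI of rank \<open>i\<close>. Non-exceptionality provides a model of \<open>T\<close> with an
  element of height 0 that satisfies \<open>lhs d\<close> and hence violates no DI of \<open>\<K>\<^sup>i\<close>. The union of such
  models for all \<open>d \<in> D\<close> with a model of \<open>\<langle>T, A\<rangle>\<close> still satisfies \<open>T\<close> and \<open>A\<close>. Rank each element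
  by the least \<open>n\<close> such that it violates no DI of \<open>\<K>\<^sup>n\<close>. Then a minimal element of \<open>lhs d\<close> has
  rank at most \<open>i\<close> because of the witness for \<open>d\<close>, so it does not violate \<open>d\<close>.
\<close>

section \<open>Types of elements\<close>

text \<open>Finitely many names give finitely many basic concepts, so the values of
  \<open>filtration_map\<close> form a finite type, which embeds into every infinite domain
  type.\<close>

instance role :: (finite) finite
proof
  have UNIV_eq: "(UNIV :: 'a role set) = range Name \<union> range Inverse"
    by (rule UNIV_eq_I) (case_tac x, auto)
  show "finite (UNIV :: 'a role set)" by (subst UNIV_eq) simp
qed

instance basic :: (finite, finite) finite
proof
  have UNIV_eq: "(UNIV :: ('a, 'b) basic set) = range Atom \<union> range Ex"
    by (rule UNIV_eq_I) (case_tac x, auto)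
  show "finite (UNIV :: ('a, 'b) basic set)" by (subst UNIV_eq) simp
qed

definition type_of :: "('d, 'i, 'c, 'r, 'z) interp_scheme \<Rightarrow> 'd \<Rightarrow> ('c, 'r) basic set" where
  "type_of I x = {B. x \<in> basic_ext I B}"

fun concept_holds :: "('c, 'r) basic set \<Rightarrow> ('c, 'r) concept \<Rightarrow> bool" where
  "concept_holds t (Pos B) \<longleftrightarrow> B \<in> t"
| "concept_holds t (Neg B) \<longleftrightarrow> B \<notin> t"

text \<open>DIs are read here as material implications, without reference to an order.\<close>

definition conforms :: "('c, 'r) di set \<Rightarrow> ('c, 'r) basic set \<Rightarrow> bool" where
  "conforms E t \<longleftrightarrow> (\<forall>d\<in>E. lhs d \<subseteq> t \<longrightarrow> Atom (rhs d) \<in> t)"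

lemma role_ext_subset_dom: "is_interp I \<Longrightarrow> role_ext I R \<subseteq> dom I \<times> dom I"
  by (cases R) (auto simp: is_interp_def)

lemma basic_ext_subset_dom:
  assumes "is_interp I"
  shows "basic_ext I B \<subseteq> dom I"
proof (cases B)
  case (Ex R)
  then show ?thesis using role_ext_subset_dom[OF assms, of R] by auto
qed (use assms in \<open>simp add: is_interp_def\<close>)

lemma in_basics_ext_iff: "x \<in> basics_ext I Bs \<longleftrightarrow> Bs \<subseteq> type_of I x"
  by (auto simp: basics_ext_def type_of_def)

lemma basics_ext_subset_dom:
  assumes "is_interp I" "Bs \<noteq> {}"
  shows "basics_ext I Bs \<subseteq> dom I"
proof -
  obtain B where "B \<in> Bs" using assms(2) by blast
  then show ?thesis
    using basic_ext_subset_dom[OF assms(1), of B] unfolding basics_ext_def by blast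
qed

lemma in_concept_ext_iff: "x \<in> dom I \<Longrightarrow> x \<in> concept_ext I C \<longleftrightarrow> concept_holds (type_of I x) C"
  by (cases C) (auto simp: type_of_def)

text \<open>Constructions that preserve the realised types thereby preserve concept inclusions.
  Nonemptiness of \<open>Bs\<close> keeps its extension inside the domain: an empty intersection
  would be the whole type.\<close>

lemma sat_concept_incl_iff:
  assumes "is_interp I" "Bs \<noteq> {}"
  shows "sat_tbox_axiom I (ConceptIncl Bs C) \<longleftrightarrow>
    (\<forall>x\<in>dom I. Bs \<subseteq> type_of I x \<longrightarrow> concept_holds (type_of I x) C)"
proof -
  have "x \<in> basics_ext I Bs \<longleftrightarrow> x \<in> dom I \<and> Bs \<subseteq> type_of I x" for x
    using basics_ext_subset_dom[OF assms] in_basics_ext_iff[of x I Bs] by blast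
  then show ?thesis by (auto simp: subset_iff in_concept_ext_iff)
qed


section \<open>Images and unions of interpretations\<close>

definition image_interp ::
  "('d \<Rightarrow> 'e) \<Rightarrow> ('d, 'i, 'c, 'r, 'z) interp_scheme \<Rightarrow> ('e, 'i, 'c, 'r) interp" where
  "image_interp g I = \<lparr>dom = g ` dom I, conc = \<lambda>A. g ` conc I A,
     rol = \<lambda>P. map_prod g g ` rol I P, ind = g \<circ> ind I\<rparr>"

lemma is_interp_image:
  assumes "is_interp I" "inj_on g (range (ind I))"
  shows "is_interp (image_interp g I)"
  using assms unfolding is_interp_def image_interp_def
  by (auto simp: comp_inj_on image_mono intro!: imageI)

lemma role_ext_image: "role_ext (image_interp g I) R = map_prod g g ` role_ext I R"
  by (cases R) (force simp: image_interp_def)+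

lemma basic_ext_image: "basic_ext (image_interp g I) B = g ` basic_ext I B"
proof (cases B)
  case (Ex R)
  then show ?thesis by (force simp: role_ext_image)
qed (simp add: image_interp_def)

text \<open>Membership of \<open>g x\<close> in an image comes from some preimage \<open>y\<close>,
  and all preimages of \<open>g x\<close> in the domain share the type of \<open>x\<close>.\<close>

lemma type_of_image:
  assumes "is_interp I" "x \<in> dom I"
    and "\<And>y. y \<in> dom I \<Longrightarrow> g y = g x \<Longrightarrow> type_of I y = type_of I x"
  shows "type_of (image_interp g I) (g x) = type_of I x"
proof -
  have "g x \<in> g ` basic_ext I B \<longleftrightarrow> x \<in> basic_ext I B" for B
  proof
    assume "g x \<in> g ` basic_ext I B"
    then obtain y where y: "y \<in> basic_ext I B" "g y = g x" by force
    then have "y \<in> dom I" using basic_ext_subset_dom[OF assms(1)] by blast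
    then have "type_of I y = type_of I x" using assms(3) y(2) by blast
    then show "x \<in> basic_ext I B" using y(1) unfolding type_of_def by blast
  qed blast
  then show ?thesis by (simp add: type_of_def basic_ext_image)
qed

text \<open>Concept inclusions see only realised types; role inclusions survive because taking
  images is monotone.\<close>

lemma sat_tbox_axiom_image:
  assumes "is_interp I" "is_interp (image_interp g I)"
    and type: "\<And>x. x \<in> dom I \<Longrightarrow> type_of (image_interp g I) (g x) = type_of I x"
    and "is_tbox T" "ax \<in> T" "sat_tbox_axiom I ax"
  shows "sat_tbox_axiom (image_interp g I) ax"
proof (cases ax)
  case (ConceptIncl Bs C)
  then have "Bs \<noteq> {}" using assms(4,5) unfolding is_tbox_def by blast
  moreover have "dom (image_interp g I) = g ` dom I" by (simp add: image_interp_def)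
  ultimately show ?thesis
    using assms(1,2,6) type unfolding ConceptIncl
    by (simp add: sat_concept_incl_iff del: sat_tbox_axiom.simps)
next
  case (RoleIncl R1 R2)
  then show ?thesis using assms(6) by (auto simp: role_ext_image)
qed

lemma sat_assertion_image: "sat_assertion I as \<Longrightarrow> sat_assertion (image_interp g I) as"
  by (cases as) (force simp: image_interp_def)+

text \<open>Members may overlap and may disagree on individuals, so the naming \<open>f\<close> is a
  separate argument.\<close>

definition union_interp ::
  "('i \<Rightarrow> 'd) \<Rightarrow> ('d, 'i, 'c, 'r) interp set \<Rightarrow> ('d, 'i, 'c, 'r) interp" where
  "union_interp f \<J> = \<lparr>dom = \<Union>J\<in>\<J>. dom J, conc = \<lambda>A. \<Union>J\<in>\<J>. conc J A,
     rol = \<lambda>P. \<Union>J\<in>\<J>. rol J P, ind = f\<rparr>"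

lemma is_interp_union:
  assumes "\<And>J. J \<in> \<J> \<Longrightarrow> is_interp J" "I \<in> \<J>"
  shows "is_interp (union_interp (ind I) \<J>)"
proof -
  let ?X = "\<Union>J\<in>\<J>. dom J"
  have I: "dom I \<subseteq> ?X" using assms(2) by (rule UN_upper)
  have "dom I \<noteq> {}" using assms(1)[OF assms(2)] unfolding is_interp_def by simp
  then have "?X \<noteq> {}" using I by (metis subset_empty)
  moreover have "\<forall>a. ind I a \<in> ?X" "inj (ind I)"
    using assms(1)[OF assms(2)] subsetD[OF I] unfolding is_interp_def by simp_all
  moreover have "\<forall>A. (\<Union>J\<in>\<J>. conc J A) \<subseteq> ?X"
    by (intro allI UN_mono) (use assms(1) in \<open>auto simp: is_interp_def\<close>)
  moreover have "\<forall>P. (\<Union>J\<in>\<J>. rol J P) \<subseteq> ?X \<times> ?X"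
  proof (intro allI UN_least)
    fix J P assume J: "J \<in> \<J>"
    then have "rol J P \<subseteq> dom J \<times> dom J" using assms(1) unfolding is_interp_def by simp
    also have "\<dots> \<subseteq> ?X \<times> ?X" using UN_upper[OF J] by (intro Sigma_mono)
    finally show "rol J P \<subseteq> ?X \<times> ?X" .
  qed
  ultimately show ?thesis
    unfolding is_interp_def union_interp_def interp.simps by - (intro conjI)
qed

lemma role_ext_union: "role_ext (union_interp f \<J>) R = (\<Union>J\<in>\<J>. role_ext J R)"
  by (cases R) (auto simp: union_interp_def)

lemma basic_ext_union: "basic_ext (union_interp f \<J>) B = (\<Union>J\<in>\<J>. basic_ext J B)"
proof (cases B)
  case (Ex R)
  then show ?thesis by (auto simp: role_ext_union)
qed (simp add: union_interp_def)

text \<open>Basic concepts are positive existential, so types in the union are unions of types.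
  Members whose domain contains \<open>x\<close> all contribute \<open>t x\<close>; the others
  contribute nothing.\<close>

lemma type_of_union:
  assumes "\<And>J. J \<in> \<J> \<Longrightarrow> is_interp J" "J \<in> \<J>" "x \<in> dom J"
    and type: "\<And>J x. J \<in> \<J> \<Longrightarrow> x \<in> dom J \<Longrightarrow> type_of J x = t x"
  shows "type_of (union_interp f \<J>) x = t x"
proof -
  have "type_of (union_interp f \<J>) x = (\<Union>J'\<in>\<J>. type_of J' x)"
    by (auto simp: type_of_def basic_ext_union)
  moreover have "type_of J' x \<subseteq> t x" if "J' \<in> \<J>" for J'
  proof (cases "x \<in> dom J'")
    case False
    then have "type_of J' x = {}"
      using basic_ext_subset_dom[OF assms(1)[OF that]] unfolding type_of_def by blast
    then show ?thesis by simp
  qed (use type that in blast)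
  ultimately show ?thesis using assms(2) type[OF assms(2,3)] by blast
qed

text \<open>Negated concepts could fail in a union; the common typing \<open>t\<close> ensures that
  no member adds basic concepts to an element of another.\<close>

lemma sat_tbox_axiom_union:
  assumes interp: "\<And>J. J \<in> \<J> \<Longrightarrow> is_interp J" and "is_interp (union_interp f \<J>)"
    and type: "\<And>J x. J \<in> \<J> \<Longrightarrow> x \<in> dom J \<Longrightarrow> type_of J x = t x"
    and "is_tbox T" "ax \<in> T" and sat: "\<And>J. J \<in> \<J> \<Longrightarrow> sat_tbox_axiom J ax"
  shows "sat_tbox_axiom (union_interp f \<J>) ax"
proof (cases ax)
  case (ConceptIncl Bs C)
  then have Bs: "Bs \<noteq> {}" using assms(4,5) unfolding is_tbox_def by blast
  have "concept_holds (type_of (union_interp f \<J>) x) C"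
    if x: "x \<in> dom (union_interp f \<J>)" and le: "Bs \<subseteq> type_of (union_interp f \<J>) x" for x
  proof -
    obtain J where J: "J \<in> \<J>" "x \<in> dom J" using x by (auto simp: union_interp_def)
    have "type_of (union_interp f \<J>) x = type_of J x"
      using type_of_union[OF interp J type] type[OF J] by simp
    then show ?thesis
      using le J(2) sat[OF J(1)] sat_concept_incl_iff[OF interp[OF J(1)] Bs]
      unfolding ConceptIncl by simp
  qed
  then show ?thesis unfolding ConceptIncl sat_concept_incl_iff[OF assms(2) Bs] by blast
next
  case (RoleIncl R1 R2)
  then show ?thesis using sat by (fastforce simp: role_ext_union)
qed

lemma sat_assertion_union:
  assumes "I \<in> \<J>" "sat_assertion I as"
  shows "sat_assertion (union_interp (ind I) \<J>) as"
  using assms by (cases as) (auto simp: union_interp_def)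


section \<open>Filtration\<close>

definition filtration_map ::
  "('d, 'i, 'c, 'r, 'z) interp_scheme \<Rightarrow> 'd \<Rightarrow> ('c, 'r) basic set \<times> 'i option" where
  "filtration_map I x =
     (type_of I x, if x \<in> range (ind I) then Some (inv (ind I) x) else None)"

lemma inj_on_filtration_map: "inj_on (filtration_map I) (range (ind I))"
  by (rule inj_onI) (simp add: filtration_map_def, metis f_inv_into_f)

lemma ex_inj_into_infinite:
  assumes "infinite (UNIV :: 'b set)"
  shows "\<exists>f :: 'a::finite \<Rightarrow> 'b. inj f"
proof -
  obtain B :: "'b set" where "finite B" "card B = card (UNIV :: 'a set)"
    using infinite_arbitrarily_large[OF assms] by blast
  then show ?thesis using card_le_inj[of "UNIV :: 'a set" B] by auto
qed

text \<open>The last claim decodes the type from the element alone, whatever \<open>I\<close> is, so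
  filtrations of different models through the same \<open>\<phi>\<close> agree on shared
  elements.\<close>

lemma filtration:
  fixes I :: "('d, 'i, 'c, 'r, 'z) interp_scheme"
    and \<phi> :: "('c, 'r) basic set \<times> 'i option \<Rightarrow> 'e"
  assumes "inj \<phi>" "is_interp I" "is_tbox T" "\<forall>ax\<in>T. sat_tbox_axiom I ax"
  defines "g \<equiv> \<phi> \<circ> filtration_map I"
  shows "is_interp (image_interp g I)"
    and "\<forall>ax\<in>T. sat_tbox_axiom (image_interp g I) ax"
    and "x \<in> dom I \<Longrightarrow> type_of (image_interp g I) (g x) = type_of I x"
    and "y \<in> dom (image_interp g I) \<Longrightarrow> type_of (image_interp g I) y = fst (inv \<phi> y)"
proof -
  have fst_g: "fst (inv \<phi> (g x)) = type_of I x" for x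
    using assms(1) by (simp add: g_def filtration_map_def)
  have "inj_on g (range (ind I))"
    unfolding g_def by (intro comp_inj_on inj_on_filtration_map inj_on_subset[OF assms(1)]) auto
  then show interp: "is_interp (image_interp g I)" by (rule is_interp_image[OF assms(2)])
  show type: "type_of (image_interp g I) (g x) = type_of I x" if "x \<in> dom I" for x
    using that fst_g by (intro type_of_image[OF assms(2)]) metis+
  show "\<forall>ax\<in>T. sat_tbox_axiom (image_interp g I) ax"
    using sat_tbox_axiom_image[OF assms(2) interp type assms(3)] assms(4) by blast
  show "type_of (image_interp g I) y = fst (inv \<phi> y)" if "y \<in> dom (image_interp g I)"
    using that type fst_g by (auto simp: image_interp_def)
qed

lemma classically_satisfiable_transfer:
  fixes I :: "('d, 'i::finite, 'c::finite, 'r::finite, 'z) interp_scheme"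
  assumes "infinite (UNIV :: 'f set)" "is_tbox T" "is_interp I"
    and "\<forall>ax\<in>T. sat_tbox_axiom I ax" "\<forall>as\<in>A. sat_assertion I as"
  shows "classically_satisfiable TYPE('f) T A"
proof -
  obtain \<phi> :: "('c, 'r) basic set \<times> 'i option \<Rightarrow> 'f" where "inj \<phi>"
    using ex_inj_into_infinite[OF assms(1)] by blast
  from filtration(1,2)[OF this assms(3,2,4)] show ?thesis
    unfolding classically_satisfiable_def using assms(5) sat_assertion_image by blast
qed


section \<open>Ranked interpretations from rank functions\<close>

text \<open>Counting smaller members enumerates \<open>S\<close> without gaps: passing to the
  predecessor in \<open>S\<close> lowers the count by exactly one.\<close>

lemma card_below_downward_closed:
  fixes S :: "nat set"
  assumes "s \<in> S" "m \<le> card (S \<inter> {..<s})"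
  shows "\<exists>s'\<in>S. card (S \<inter> {..<s'}) = m"
  using assms
proof (induction s rule: less_induct)
  case (less s)
  show ?case
  proof (cases "m = card (S \<inter> {..<s})")
    case False
    define s' where "s' = Max (S \<inter> {..<s})"
    have fin: "finite (S \<inter> {..<s})" by simp
    have ne: "S \<inter> {..<s} \<noteq> {}" using False less.prems(2) by auto
    have s': "s' \<in> S" "s' < s" using Max_in[OF fin ne] by (auto simp: s'_def)
    have "S \<inter> {..<s} = insert s' (S \<inter> {..<s'})"
      using s' Max_ge[OF fin] by (force simp: s'_def order.order_iff_strict)
    then have "card (S \<inter> {..<s}) = Suc (card (S \<inter> {..<s'}))" by simp
    then show ?thesis using less.IH[OF s'(2,1)] False less.prems(2) by simp
  qed (use less.prems in blast)
qed

definition ranked_by ::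
  "('d \<Rightarrow> nat) \<Rightarrow> ('d, 'i, 'c, 'r) interp \<Rightarrow> ('d, 'i, 'c, 'r) ranked_interp" where
  "ranked_by r J = interp.extend J
     \<lparr>prec = {(x, y). x \<in> dom J \<and> y \<in> dom J \<and> r x < r y}\<rparr>"

lemma ranked_by_simps [simp]:
  "dom (ranked_by r J) = dom J"
  "conc (ranked_by r J) = conc J"
  "rol (ranked_by r J) = rol J"
  "ind (ranked_by r J) = ind J"
  "prec (ranked_by r J) = {(x, y). x \<in> dom J \<and> y \<in> dom J \<and> r x < r y}"
  by (simp_all add: ranked_by_def interp.defs)

lemma role_ext_ranked_by [simp]: "role_ext (ranked_by r J) = role_ext J"
proof
  show "role_ext (ranked_by r J) R = role_ext J R" for R by (cases R) simp_all
qed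

lemma basic_ext_ranked_by [simp]: "basic_ext (ranked_by r J) = basic_ext J"
proof
  show "basic_ext (ranked_by r J) B = basic_ext J B" for B by (cases B) simp_all
qed

lemma basics_ext_ranked_by [simp]: "basics_ext (ranked_by r J) = basics_ext J"
  by (simp add: fun_eq_iff basics_ext_def)

lemma concept_ext_ranked_by [simp]: "concept_ext (ranked_by r J) = concept_ext J"
proof
  show "concept_ext (ranked_by r J) C = concept_ext J C" for C by (cases C) simp_all
qed

lemma sat_tbox_axiom_ranked_by [simp]: "sat_tbox_axiom (ranked_by r J) ax = sat_tbox_axiom J ax"
  by (cases ax) simp_all

lemma sat_assertion_ranked_by [simp]: "sat_assertion (ranked_by r J) as = sat_assertion J as"
  by (cases as) simp_all

lemma is_ranked_interp_ranked_by:
  assumes "is_interp J"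
  shows "is_ranked_interp (ranked_by r J)"
proof -
  let ?S = "r ` dom J"
  \<comment> \<open>On the domain \<open>h\<close> induces the same order as \<open>r\<close>, but
    the gaps in the range are closed.\<close>
  define h where "h x = card (?S \<inter> {..<r x})" for x
  have mono: "h x \<le> h y" if "r x \<le> r y" for x y
    unfolding h_def using that by (intro card_mono) auto
  have strict: "h x < h y" if "x \<in> dom J" "r x < r y" for x y
    unfolding h_def using that by (intro psubset_card_mono) auto
  have "h x < h y \<longleftrightarrow> r x < r y" if "x \<in> dom J" for x y
    using mono[of y x] strict[OF that, of y] by linarith
  moreover have "m \<in> h ` dom J" if "x \<in> dom J" "m \<le> h x" for x m
    using card_below_downward_closed[of "r x" ?S m] that unfolding h_def by auto
  ultimately have "height_function (ranked_by r J) h"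
    unfolding height_function_def by auto
  then show ?thesis
    using assms unfolding is_ranked_interp_def is_interp_def
    by (auto simp: irrefl_def trans_def)
qed

text \<open>The witness \<open>x\<close> competes with any minimal \<open>y\<close>, so
  \<open>y\<close> is ranked at most \<open>n\<close>; hence \<open>d\<close> still belongs to the
  set of DIs to which \<open>y\<close> conforms.\<close>

lemma sat_di_ranked_by_conformity:
  assumes "is_interp J" "lhs d \<noteq> {}" "antimono E" "E N = {}"
    and "x \<in> dom J" "lhs d \<subseteq> type_of J x" "d \<in> E n" "conforms (E n) (type_of J x)"
  shows "sat_di (ranked_by (\<lambda>x. LEAST n. conforms (E n) (type_of J x)) J) d"
  unfolding sat_di_def
proof
  define r where "r x = (LEAST n. conforms (E n) (type_of J x))" for x
  \<comment> \<open>At index \<open>N\<close> conformity is vacuous, so the least index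
    exists.\<close>
  have conf: "conforms (E (r y)) (type_of J y)" for y
    unfolding r_def by (rule LeastI[of _ N]) (simp add: conforms_def assms(4))
  fix y
  assume "y \<in> minimal_elems (ranked_by (\<lambda>x. LEAST n. conforms (E n) (type_of J x)) J)
    (basics_ext (ranked_by (\<lambda>x. LEAST n. conforms (E n) (type_of J x)) J) (lhs d))"
  then have y: "lhs d \<subseteq> type_of J y"
    and min: "\<And>z. lhs d \<subseteq> type_of J z \<Longrightarrow> z \<in> dom J \<Longrightarrow> y \<in> dom J \<Longrightarrow> \<not> r z < r y"
    by (auto simp: minimal_elems_def in_basics_ext_iff r_def)
  have "y \<in> dom J"
    using y basics_ext_subset_dom[OF assms(1,2)] in_basics_ext_iff[of y J] by blast
  then have "r y \<le> r x" using min[OF assms(6,5)] by simp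
  also have "r x \<le> n" unfolding r_def using assms(8) by (rule Least_le)
  finally have "d \<in> E (r y)" using assms(3,7) by (auto dest: antimonoD)
  then show "y \<in> conc (ranked_by (\<lambda>x. LEAST n. conforms (E n) (type_of J x)) J) (rhs d)"
    using conf y unfolding conforms_def type_of_def by fastforce
qed


section \<open>Witnesses for finite rank\<close>

lemma antimono_residual: "antimono (residual U V T D)"
  by (rule decseq_SucI) auto

lemma residual_eventually_empty:
  assumes "finite D" "\<forall>d\<in>D. di_rank U V T D d \<noteq> \<infinity>"
  shows "\<exists>N. residual U V T D N = {}"
proof -
  define k where "k d = the_enat (di_rank U V T D d)" for d
  have k: "di_rank U V T D d = enat (k d)" if "d \<in> D" for d
    using assms(2) that unfolding k_def by auto
  \<comment> \<open>A residual lacks only the ranks strictly below its index, hence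
    \<open>Suc\<close>. For empty \<open>D\<close> the value of \<open>Max\<close> is unspecified,
    but then every residual is empty.\<close>
  have "k d < Suc (Max (k ` D))" if "d \<in> D" for d
    using assms(1) that by (simp add: less_Suc_eq_le)
  then have "residual U V T D (Suc (Max (k ` D))) = {}"
    using k unfolding residual_eq by blast
  then show ?thesis by blast
qed

text \<open>Nothing lies below an element of height 0, so it is minimal in every left-hand side that
  it satisfies.\<close>

lemma height_zero_conforms:
  assumes "ranked_model R T D A" "x \<in> dom R" "height R x = 0"
  shows "conforms D (type_of R x)"
  unfolding conforms_def
proof (intro ballI impI)
  fix d assume d: "d \<in> D" "lhs d \<subseteq> type_of R x"
  have R: "is_ranked_interp R" "sat_di R d" using assms(1) d(1) unfolding ranked_model_def by auto
  then obtain h where h: "height_function R h" unfolding is_ranked_interp_def by blast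
  have "h x = 0" using height_eq[OF h assms(2)] assms(3) by simp
  then have "(y, x) \<notin> prec R" for y
    using R(1) h unfolding is_ranked_interp_def height_function_def by fastforce
  then have "x \<in> minimal_elems R (basics_ext R (lhs d))"
    using d(2) by (simp add: minimal_elems_def in_basics_ext_iff)
  then show "Atom (rhs d) \<in> type_of R x"
    using R(2) unfolding sat_di_def type_of_def by auto
qed

lemma finite_rank_witness:
  fixes T :: "('c, 'r) tbox_axiom set"
  assumes "d \<in> D" "di_rank TYPE('d) TYPE('i) T D d \<noteq> \<infinity>"
  obtains n x and R :: "('d, 'i, 'c, 'r) ranked_interp" where
    "is_interp R" "\<forall>ax\<in>T. sat_tbox_axiom R ax" "x \<in> dom R" "lhs d \<subseteq> type_of R x"
    "d \<in> residual TYPE('d) TYPE('i) T D n"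
    "conforms (residual TYPE('d) TYPE('i) T D n) (type_of R x)"
proof -
  let ?E = "residual TYPE('d) TYPE('i) T D"
  define n where "n = (LEAST i. \<not> exceptional TYPE('d) TYPE('i) T (?E i) (Pos ` lhs d))"
  have ex: "\<exists>i. \<not> exceptional TYPE('d) TYPE('i) T (?E i) (Pos ` lhs d)"
    and rank: "di_rank TYPE('d) TYPE('i) T D d = enat n"
    using assms(2) unfolding di_rank_def rank_def n_def by (auto split: if_splits)
  from LeastI_ex[OF ex]
  obtain R :: "('d, 'i, 'c, 'r) ranked_interp" and x where
    R: "ranked_model R T (?E n) {}" and x: "x \<in> dom R" "height R x = 0"
    "\<forall>C\<in>Pos ` lhs d. x \<in> concept_ext R C"
    unfolding exceptional_def n_def by blast
  show thesis
  proof (rule that)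
    show "is_interp R" "\<forall>ax\<in>T. sat_tbox_axiom R ax"
      using R unfolding ranked_model_def is_ranked_interp_def by auto
    show "x \<in> dom R" by (fact x)
    show "lhs d \<subseteq> type_of R x" using x(3) by (auto simp: type_of_def)
    \<comment> \<open>Only ranks below \<open>n\<close> have been removed at index \<open>n\<close>,
      and \<open>d\<close> has rank exactly \<open>n\<close>.\<close>
    show "d \<in> ?E n" using assms(1) rank by (simp add: residual_eq)
    show "conforms (?E n) (type_of R x)" by (rule height_zero_conforms[OF R x(1,2)])
  qed
qed

text \<open>Rank, ranked satisfiability and classical satisfiability each refer to their own
  infinite domain type; filtration moves models between these types.\<close>

theorem proposition17:
  fixes T :: "('c::finite, 'r::finite) tbox_axiom set"
    and D :: "('c, 'r) di set"
    and A :: "('i::finite, 'c, 'r) assertion set"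
  assumes "infinite (UNIV :: 'd set)"
    and "infinite (UNIV :: 'e set)"
    and "infinite (UNIV :: 'f set)"
    and "is_kb T D A"
    and "processed TYPE('d) TYPE('i) T D"
  shows "satisfiable TYPE('e) T D A \<longleftrightarrow> classically_satisfiable TYPE('f) T A"
proof
  have T: "is_tbox T" and D: "is_dbox D" using assms(4) unfolding is_kb_def by auto
  {
    assume "satisfiable TYPE('e) T D A"
    then obtain R :: "('e, 'i, 'c, 'r) ranked_interp" where "ranked_model R T D A"
      unfolding satisfiable_def by blast
    \<comment> \<open>The transfer lemma is stated for record schemes, so it applies to
      \<open>R\<close> with its order field.\<close>
    then show "classically_satisfiable TYPE('f) T A"
      using classically_satisfiable_transfer[OF assms(3) T, of R A]
      unfolding ranked_model_def is_ranked_interp_def by blast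
  }
  assume "classically_satisfiable TYPE('f) T A"
  then obtain I :: "('f, 'i, 'c, 'r) interp" where
    I: "is_interp I" "\<forall>ax\<in>T. sat_tbox_axiom I ax" "\<forall>as\<in>A. sat_assertion I as"
    unfolding classically_satisfiable_def by blast
  let ?E = "residual TYPE('d) TYPE('i) T D"
  have fin: "\<forall>d\<in>D. di_rank TYPE('d) TYPE('i) T D d \<noteq> \<infinity>"
    using assms(5) unfolding processed_def by blast
  obtain N where N: "?E N = {}"
    using residual_eventually_empty[OF _ fin] D unfolding is_dbox_def by blast
  obtain \<phi> :: "('c, 'r) basic set \<times> 'i option \<Rightarrow> 'e" where \<phi>: "inj \<phi>"
    using ex_inj_into_infinite[OF assms(2)] by blast
  define t where "t y = fst (inv \<phi> y)" for y
  \<comment> \<open>Since \<open>t\<close> does not depend on the interpretation, all members agree on the types of shared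
    elements, so that their union leaves types unchanged.\<close>
  define \<J> :: "('e, 'i, 'c, 'r) interp set" where
    "\<J> = {J. is_interp J \<and> (\<forall>ax\<in>T. sat_tbox_axiom J ax) \<and> (\<forall>x\<in>dom J. type_of J x = t x)}"
  define I' where "I' = image_interp (\<phi> \<circ> filtration_map I) I"
  \<comment> \<open>Individuals are named as in the filtered model of \<open>T\<close> and
    \<open>A\<close>, so that the assertions carry over; the namings of the other members are
    discarded.\<close>
  define U where "U = union_interp (ind I') \<J>"
  have I': "I' \<in> \<J>"
    using filtration(1,2,4)[OF \<phi> I(1) T I(2)] unfolding \<J>_def I'_def t_def by blast
  have \<J>_interp: "is_interp J" if "J \<in> \<J>" for J using that unfolding \<J>_def by blast
  have \<J>_type: "type_of J x = t x" if "J \<in> \<J>" "x \<in> dom J" for J x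
    using that unfolding \<J>_def by blast
  have U_interp: "is_interp U" unfolding U_def by (rule is_interp_union[OF \<J>_interp I'])
  have U_tbox: "\<forall>ax\<in>T. sat_tbox_axiom U ax"
  proof
    fix ax assume "ax \<in> T"
    moreover from this have "sat_tbox_axiom J ax" if "J \<in> \<J>" for J
      using that unfolding \<J>_def by blast
    ultimately show "sat_tbox_axiom U ax"
      using sat_tbox_axiom_union[OF \<J>_interp U_interp[unfolded U_def] \<J>_type T]
      unfolding U_def by blast
  qed
  have U_abox: "\<forall>as\<in>A. sat_assertion U as"
    using I(3) sat_assertion_image sat_assertion_union[OF I'] unfolding U_def I'_def by blast
  have "sat_di (ranked_by (\<lambda>x. LEAST n. conforms (?E n) (type_of U x)) U) d" if d: "d \<in> D" for d
  proof -
    have "di_rank TYPE('d) TYPE('i) T D d \<noteq> \<infinity>" using fin d by blast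
    then obtain n x and R :: "('d, 'i, 'c, 'r) ranked_interp" where
      R: "is_interp R" "\<forall>ax\<in>T. sat_tbox_axiom R ax" "x \<in> dom R" "lhs d \<subseteq> type_of R x"
      "d \<in> ?E n" "conforms (?E n) (type_of R x)"
      by (rule finite_rank_witness[OF d])
    \<comment> \<open>Filtering through the same \<open>\<phi>\<close> brings the witness model from
      \<open>'d\<close> into \<open>\<J>\<close>, and the union keeps the type of
      \<open>x\<close>.\<close>
    let ?g = "\<phi> \<circ> filtration_map R"
    have J: "image_interp ?g R \<in> \<J>"
      using filtration(1,2,4)[OF \<phi> R(1) T R(2)] unfolding \<J>_def t_def by blast
    have gx: "?g x \<in> dom (image_interp ?g R)" using R(3) by (simp add: image_interp_def)
    have type: "type_of U (?g x) = type_of R x"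
      using type_of_union[OF \<J>_interp J gx \<J>_type] \<J>_type[OF J gx]
        filtration(3)[OF \<phi> R(1) T R(2,3)]
      unfolding U_def by simp
    have "?g x \<in> dom U" using J gx unfolding U_def union_interp_def by auto
    then show ?thesis
      using sat_di_ranked_by_conformity[OF U_interp _ antimono_residual N, of d "?g x" n]
        D d R(4-6) type
      unfolding is_dbox_def by simp
  qed
  then have "ranked_model (ranked_by (\<lambda>x. LEAST n. conforms (?E n) (type_of U x)) U) T D A"
    unfolding ranked_model_def
    using is_ranked_interp_ranked_by[OF U_interp] U_tbox U_abox by simp
  then show "satisfiable TYPE('e) T D A" unfolding satisfiable_def by blast
qed

end
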